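(* Let $E(X)$ be the Köthe-Bochner space associated with a Banach function space $E$ on the complete probability measure space $(\Omega,\Sigma,\mu)$ and a Banach space $X$. Let $T$ be an operator (bounded linear operator) on $E(X)$. Then $T$ is a multiplication operator (i.e. there is $a\in L^\infty(\mu)$ with $T(f)=af$ for all $f\in E(X)$) if and only if both of the following conditions hold: (iia) for each $x\in X$, the cyclic subspace $E(\overset{\rightarrow}{x})$ is left invariant by $T$, i.e. $T(E(\overset{\rightarrow}{x}))\subset E(\overset{\rightarrow}{x})$; (iic) $T$ commutes with $L^\infty(\mu)$ on $E(X)$, i.e. $T(af)=aT(f)$ for all $a\in L^\infty(\mu)$ and $f\in E(X)$.
   Context: Scalars are real. $(\Omega,\Sigma,\mu)$ is a complete probability measure space and $L(\mu)$ is the vector lattice of (classes of) a.e. finite measurable functions. A Banach function space $E$ here means: $E$ is an order ideal of $L^1(\mu)$, a Banach lattice under its own norm $\|\cdot\|_E$, with continuous embedding $E\subset L^1(\mu)$, and the constant function $1$ belongs to $E$ with $\|1\|_E=1$ (so $L^\infty(\mu)\subset E$). $L(\mu,X)$ denotes the space of (a.e. equivalence classes of) strongly measurable functions $f:\Omega\to X$, i.e. Borel measurable functions such that $f(\Omega\setminus A)$ is separable for some $A\in\Sigma$ with $\mu(A)=0$. For $f\in L(\mu,X)$, its norm function is $|f|_X(t)=\|f(t)\|$. The Köthe-Bochner space is $E(X)=\{f\in L(\mu,X): |f|_X\in E\}$ with norm $\|f\|_{E(X)}=\|\,|f|_X\|_E$; it is a Banach $L^\infty(\mu)$-module under pointwise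 multiplication. For $x\in X$, $\overset{\rightarrow}{x}$ is the constant function with value $x$, and the cyclic subspace $E(\overset{\rightarrow}{x})$ is the norm closure of $\{a\overset{\rightarrow}{x}: a\in L^\infty(\mu)\}$ in $E(X)$. *)

theory Defs
  imports "HOL-Probability.Probability"
begin

text \<open>
  Elements of the function spaces below are classes of functions modulo equality
  almost everywhere. As in the library's treatment of Lebesgue spaces, they are
  represented by functions: a space is the set of all representatives of its
  elements, and equality of elements is \<^term>\<open>AE t in M. f t = g t\<close>.
\<close>

definition Linfty :: "'w measure \<Rightarrow> ('w \<Rightarrow> real) set" where
  "Linfty M = {a \<in> borel_measurable M. \<exists>C. AE t in M. \<bar>a t\<bar> \<le> C}"

text \<open>
  The second condition of \<open>strongly_measurable\<close> is not implied by the first,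
  since the codomain is not assumed to be separable.
\<close>

definition strongly_measurable :: "'w measure \<Rightarrow> ('w \<Rightarrow> 'x::real_normed_vector) \<Rightarrow> bool" where
  "strongly_measurable M f \<longleftrightarrow>
     f \<in> borel_measurable M \<and>
     (\<exists>A\<in>sets M. emeasure M A = 0 \<and> separable_space (top_of_set (f ` (space M - A))))"

text \<open>
  In \<open>banach_function_space M E N\<close> the set \<open>E\<close> is an order ideal of \<open>L\<^sup>1\<close> and
  \<open>N\<close> is its norm. An ideal inherits its lattice operations from \<open>L\<^sup>1\<close>, so only the
  monotonicity of the norm remains of the Banach lattice structure. The values of
  \<open>N\<close> outside \<open>E\<close> are irrelevant. By \<open>ideal\<close> and \<open>norm_mono\<close>, \<open>E\<close> and \<open>N\<close> are
  compatible with equality almost everywhere.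
\<close>

locale banach_function_space = prob_space M + complete_measure M
  for M :: "'w measure" +
  fixes E :: "('w \<Rightarrow> real) set" and N :: "('w \<Rightarrow> real) \<Rightarrow> real"
  assumes integrable: "\<And>f. f \<in> E \<Longrightarrow> integrable M f"
    and add: "\<And>f g. f \<in> E \<Longrightarrow> g \<in> E \<Longrightarrow> (\<lambda>t. f t + g t) \<in> E"
    and scale: "\<And>c f. f \<in> E \<Longrightarrow> (\<lambda>t. c * f t) \<in> E"
    and ideal: "\<And>f g. f \<in> E \<Longrightarrow> g \<in> borel_measurable M \<Longrightarrow> AE t in M. \<bar>g t\<bar> \<le> \<bar>f t\<bar> \<Longrightarrow> g \<in> E"
    and norm_nonneg: "\<And>f. f \<in> E \<Longrightarrow> 0 \<le> N f"
    and norm_eq_0_iff: "\<And>f. f \<in> E \<Longrightarrow> N f = 0 \<longleftrightarrow> (AE t in M. f t = 0)"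
    and norm_triangle: "\<And>f g. f \<in> E \<Longrightarrow> g \<in> E \<Longrightarrow> N (\<lambda>t. f t + g t) \<le> N f + N g"
    and norm_scale: "\<And>c f. f \<in> E \<Longrightarrow> N (\<lambda>t. c * f t) = \<bar>c\<bar> * N f"
    and norm_mono: "\<And>f g. f \<in> E \<Longrightarrow> g \<in> E \<Longrightarrow> AE t in M. \<bar>g t\<bar> \<le> \<bar>f t\<bar> \<Longrightarrow> N g \<le> N f"
    and norm_complete:
      "\<And>u :: nat \<Rightarrow> 'w \<Rightarrow> real.
         (\<And>n. u n \<in> E) \<Longrightarrow>
         (\<And>e. e > 0 \<Longrightarrow> \<exists>n0. \<forall>m\<ge>n0. \<forall>n\<ge>n0. N (\<lambda>t. u m t - u n t) < e) \<Longrightarrow>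
         \<exists>f\<in>E. (\<lambda>n. N (\<lambda>t. u n t - f t)) \<longlonglongrightarrow> 0"
    and embedding: "\<exists>C. \<forall>f\<in>E. (LINT t|M. \<bar>f t\<bar>) \<le> C * N f"
    and one: "(\<lambda>t. 1) \<in> E"
    and norm_one: "N (\<lambda>t. 1) = 1"

definition kb_space ::
  "'w measure \<Rightarrow> ('w \<Rightarrow> real) set \<Rightarrow> ('w \<Rightarrow> 'x::real_normed_vector) set" where
  "kb_space M E = {f. strongly_measurable M f \<and> (\<lambda>t. norm (f t)) \<in> E}"

definition kb_norm :: "(('w \<Rightarrow> real) \<Rightarrow> real) \<Rightarrow> ('w \<Rightarrow> 'x::real_normed_vector) \<Rightarrow> real" where
  "kb_norm N f = N (\<lambda>t. norm (f t))"

text \<open>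
  The condition \<open>T_cong\<close> says that \<open>T\<close> acts on classes modulo equality almost everywhere.
\<close>

locale kb_operator = banach_function_space M E N
  for M :: "'w measure" and E N +
  fixes T :: "('w \<Rightarrow> 'x::banach) \<Rightarrow> ('w \<Rightarrow> 'x)"
  assumes T_in: "\<And>f. f \<in> kb_space M E \<Longrightarrow> T f \<in> kb_space M E"
    and T_cong: "\<And>f g. f \<in> kb_space M E \<Longrightarrow> g \<in> kb_space M E \<Longrightarrow>
      AE t in M. f t = g t \<Longrightarrow> AE t in M. T f t = T g t"
    and T_add: "\<And>f g. f \<in> kb_space M E \<Longrightarrow> g \<in> kb_space M E \<Longrightarrow>
      AE t in M. T (\<lambda>s. f s + g s) t = T f t + T g t"
    and T_scale: "\<And>c f. f \<in> kb_space M E \<Longrightarrow>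
      AE t in M. T (\<lambda>s. c *\<^sub>R f s) t = c *\<^sub>R T f t"
    and T_bounded: "\<exists>K. \<forall>f\<in>kb_space M E. kb_norm N (T f) \<le> K * kb_norm N f"

definition multiplication_operator ::
  "'w measure \<Rightarrow> ('w \<Rightarrow> real) set \<Rightarrow> (('w \<Rightarrow> 'x::real_normed_vector) \<Rightarrow> ('w \<Rightarrow> 'x)) \<Rightarrow> bool" where
  "multiplication_operator M E T \<longleftrightarrow>
     (\<exists>a\<in>Linfty M. \<forall>f\<in>kb_space M E. AE t in M. T f t = a t *\<^sub>R f t)"

definition commutes_with_Linfty ::
  "'w measure \<Rightarrow> ('w \<Rightarrow> real) set \<Rightarrow> (('w \<Rightarrow> 'x::real_normed_vector) \<Rightarrow> ('w \<Rightarrow> 'x)) \<Rightarrow> bool" where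
  "commutes_with_Linfty M E T \<longleftrightarrow>
     (\<forall>a\<in>Linfty M. \<forall>f\<in>kb_space M E. AE t in M. T (\<lambda>s. a s *\<^sub>R f s) t = a t *\<^sub>R T f t)"

text \<open>The norm closure in \<open>E(X)\<close> of the set of all \<open>a x\<close> with \<open>a\<close> in \<open>L\<^sup>\<infinity>\<close>, for constant \<open>x\<close>.\<close>

definition cyclic_subspace ::
  "'w measure \<Rightarrow> ('w \<Rightarrow> real) set \<Rightarrow> (('w \<Rightarrow> real) \<Rightarrow> real) \<Rightarrow> 'x::real_normed_vector \<Rightarrow> ('w \<Rightarrow> 'x) set" where
  "cyclic_subspace M E N x =
     {f \<in> kb_space M E. \<forall>e>0. \<exists>a\<in>Linfty M. kb_norm N (\<lambda>t. f t - a t *\<^sub>R x) < e}"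

end

theory Submission
  imports Defs
begin

text \<open>
  A multiplication operator commutes with \<open>L\<^sup>\<infinity>\<close>, and it maps an approximation \<open>b x\<close> of
  \<open>f \<in> E(x)\<close> to the approximation \<open>a b x\<close> of \<open>a f\<close>; this is the easy direction.

  For the other direction, commuting with indicator functions turns the norm bound of \<open>T\<close>
  into a pointwise one: restricting \<open>f\<close> to the set where \<open>\<bar>T f\<bar> > K \<bar>f\<bar>\<close> with
  \<open>K\<close> above the operator norm shows that this set is null (\<open>pointwise_domination\<close>). Hence
  \<open>\<bar>T f - T g\<bar> \<le> K \<bar>f - g\<bar>\<close> almost everywhere, for all \<open>f\<close> and \<open>g\<close>.

  Invariance of the cyclic subspaces says that for each vector \<open>x\<close> the value of \<open>T x\<close> at
  almost every point is a multiple of \<open>x\<close> (\<open>cyclic_subspace_AE_span\<close>). A linear map for which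
  every vector is an eigenvector is a scalar. Applied at almost every point to \<open>x\<close>, \<open>y\<close> and
  \<open>x + y\<close>, the same argument gives one function \<open>a \<in> L\<^sup>\<infinity>\<close> with \<open>T y = a y\<close> almost
  everywhere for all constants \<open>y\<close> (\<open>constants_common_multiplier\<close>); the exceptional null set
  depends on \<open>y\<close>.

  Simple functions need not be dense in \<open>E(X)\<close>, so the passage from constants to a general
  \<open>f\<close> is made pointwise. Almost all values of \<open>f\<close> lie in the closure of a countable set
  \<open>D\<close>. Outside one null set \<open>\<bar>T f(t) - a(t) d\<bar> \<le> K \<bar>f(t) - d\<bar>\<close> for all
  \<open>d \<in> D\<close>, and letting \<open>d\<close> tend to \<open>f(t)\<close> gives \<open>T f(t) = a(t) f(t)\<close>.
\<close>

section \<open>Strong measurability\<close>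

lemma separable_space_top_of_set_iff:
  fixes S :: "'a::metric_space set"
  shows "separable_space (top_of_set S) \<longleftrightarrow> (\<exists>D. countable D \<and> S \<subseteq> closure D)"
proof
  assume "separable_space (top_of_set S)"
  then show "\<exists>D. countable D \<and> S \<subseteq> closure D"
    by (auto simp: separable_space_def closure_of_subtopology Int_absorb1)
next
  assume "\<exists>D. countable D \<and> S \<subseteq> closure D"
  then obtain D where D: "countable D" "S \<subseteq> closure D" by blast
  \<comment> \<open>\<open>D\<close> need not meet \<open>S\<close>, so each ball around a point of \<open>D\<close> contributes a point of \<open>S\<close>.\<close>
  define I where "I = {(d, n) \<in> D \<times> (UNIV :: nat set). S \<inter> ball d (1 / Suc n) \<noteq> {}}"
  define p where "p = (\<lambda>(d, n :: nat). SOME s. s \<in> S \<inter> ball d (1 / Suc n))"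
  have p: "p (d, n) \<in> S \<inter> ball d (1 / Suc n)" if "(d, n) \<in> I" for d n
  proof -
    have "\<exists>s. s \<in> S \<inter> ball d (1 / Suc n)" using that unfolding I_def by blast
    then show ?thesis unfolding p_def prod.case by (rule someI_ex)
  qed
  have "countable I"
    unfolding I_def by (rule countable_subset[of _ "D \<times> UNIV"]) (use D in auto)
  then have "countable (p ` I)" by simp
  moreover have "p ` I \<subseteq> S" using p by fast
  moreover have "S \<subseteq> closure (p ` I)"
  proof
    fix s assume s: "s \<in> S"
    show "s \<in> closure (p ` I)"
      unfolding closure_approachable
    proof (intro allI impI)
      fix e :: real assume "e > 0"
      then obtain n :: nat where n: "1 / Suc n < e / 2"
        using nat_approx_posE[of "e / 2"] by auto
      obtain d where d: "d \<in> D" "dist d s < 1 / Suc n"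
        using s D(2) unfolding subset_iff closure_approachable
        by (metis of_nat_0_less_iff zero_less_Suc zero_less_divide_1_iff)
      then have I: "(d, n) \<in> I" using s by (auto simp: I_def)
      have "dist d (p (d, n)) < 1 / Suc n" using p[OF I] by simp
      then have "dist (p (d, n)) s < e"
        using d(2) n dist_triangle[of "p (d, n)" s d] by (simp add: dist_commute)
      then show "\<exists>y\<in>p ` I. dist y s < e" using I by blast
    qed
  qed
  ultimately show "separable_space (top_of_set S)"
    unfolding separable_space_def
    by (intro exI[of _ "p ` I"]) (simp add: closure_of_subtopology Int_absorb1 Int_absorb2)
qed

text \<open>
  Here \<open>D\<close> need not consist of values of \<open>f\<close>. This makes the condition stable under
  continuous maps, and \<open>D\<close> can later serve as the set of constants that approximate \<open>f\<close>.
\<close>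

lemma strongly_measurable_iff:
  "strongly_measurable M f \<longleftrightarrow>
    f \<in> borel_measurable M \<and> (\<exists>D. countable D \<and> (AE t in M. f t \<in> closure D))"
proof
  assume "strongly_measurable M f"
  then obtain A D where f: "f \<in> borel_measurable M" and A: "A \<in> sets M" "emeasure M A = 0"
    and D: "countable D" "f ` (space M - A) \<subseteq> closure D"
    unfolding strongly_measurable_def separable_space_top_of_set_iff by blast
  have "AE t in M. f t \<in> closure D"
    by (rule AE_I[of _ _ A]) (use A D in auto)
  then show "f \<in> borel_measurable M \<and> (\<exists>D. countable D \<and> (AE t in M. f t \<in> closure D))"
    using f D by blast
next
  assume "f \<in> borel_measurable M \<and> (\<exists>D. countable D \<and> (AE t in M. f t \<in> closure D))"
  then obtain D where f: "f \<in> borel_measurable M" and D: "countable D"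
    and "AE t in M. f t \<in> closure D" by blast
  then obtain A where A: "A \<in> sets M" "emeasure M A = 0"
      "{t \<in> space M. f t \<notin> closure D} \<subseteq> A"
    by (elim AE_E)
  then have "f ` (space M - A) \<subseteq> closure D" by auto
  then show "strongly_measurable M f"
    unfolding strongly_measurable_def separable_space_top_of_set_iff
    by (intro conjI bexI[of _ A] exI[of _ D] f D A)
qed

lemma strongly_measurable_real:
  fixes f :: "'w \<Rightarrow> real"
  assumes "f \<in> borel_measurable M"
  shows "strongly_measurable M f"
proof -
  have "AE t in M. f t \<in> closure \<rat>" by (simp add: Rats_closure_real)
  then show ?thesis
    unfolding strongly_measurable_iff using assms countable_rat by blast
qed

text \<open>
  Without a second countable codomain, the pair \<open>(f, g)\<close> of two Borel functions need not be
  Borel. Strong measurability repairs this: away from a null set, the preimage of an open set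
  is a countable union of measurable rectangles whose sides are preimages of balls around the
  points of countable sets whose closures contain almost all values. The null set itself is
  absorbed by the completeness of the measure.
\<close>

lemma (in complete_measure) strongly_measurable_continuous_Pair:
  fixes h :: "'b::real_normed_vector \<times> 'c::real_normed_vector \<Rightarrow> 'd::real_normed_vector"
  assumes h: "continuous_on UNIV h"
    and f: "strongly_measurable M f" and g: "strongly_measurable M g"
  shows "strongly_measurable M (\<lambda>t. h (f t, g t))"
proof -
  obtain D where [measurable]: "f \<in> borel_measurable M" and D: "countable D"
    and fD: "AE t in M. f t \<in> closure D"
    using f unfolding strongly_measurable_iff by blast
  obtain D' where [measurable]: "g \<in> borel_measurable M" and D': "countable D'"
    and gD: "AE t in M. g t \<in> closure D'"
    using g unfolding strongly_measurable_iff by blast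
  have "AE t in M. f t \<in> closure D \<and> g t \<in> closure D'" using fD gD by eventually_elim auto
  then obtain A where A: "A \<in> null_sets M"
    and fgA: "{t \<in> space M. \<not> (f t \<in> closure D \<and> g t \<in> closure D')} \<subseteq> A"
    by (auto simp: eventually_ae_filter)
  have "(\<lambda>t. h (f t, g t)) \<in> borel_measurable M"
  proof (rule borel_measurableI)
    fix W :: "'d set" assume W: "open W"
    define V where "V = h -` W"
    have V: "open V" unfolding V_def using open_vimage[OF W h] .
    let ?P = "(\<lambda>t. h (f t, g t)) -` W \<inter> space M"
    define I where "I = {(d, d', n). d \<in> D \<and> d' \<in> D' \<and>
      ball d (1 / Suc n) \<times> ball d' (1 / Suc n) \<subseteq> V}"
    define R where "R = (\<lambda>(d, d', n :: nat).
      {t \<in> space M. dist d (f t) < 1 / Suc n} \<inter> {t \<in> space M. dist d' (g t) < 1 / Suc n})"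
    have "countable I"
      unfolding I_def by (rule countable_subset[of _ "D \<times> D' \<times> UNIV"]) (use D D' in auto)
    moreover have "R i \<in> sets M" for i
    proof -
      obtain d d' n where i: "i = (d, d', n)" using prod_cases3 by blast
      have "(\<lambda>t. dist d (f t)) \<in> borel_measurable M"
        by (rule borel_measurable_continuous_on[of "dist d"]) (intro continuous_intros, measurable)
      moreover have "(\<lambda>t. dist d' (g t)) \<in> borel_measurable M"
        by (rule borel_measurable_continuous_on[of "dist d'"]) (intro continuous_intros, measurable)
      ultimately show ?thesis unfolding i R_def prod.case by measurable
    qed
    ultimately have R: "(\<Union>i\<in>I. R i) \<in> sets M" by (intro sets.countable_UN') auto
    have sub: "(\<Union>i\<in>I. R i) \<subseteq> ?P"
    proof
      fix t assume "t \<in> (\<Union>i\<in>I. R i)"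
      then obtain d d' n where "(d, d', n) \<in> I" and t: "t \<in> R (d, d', n)" by auto
      then have "ball d (1 / Suc n) \<times> ball d' (1 / Suc n) \<subseteq> V" by (simp add: I_def)
      moreover have "f t \<in> ball d (1 / Suc n)" "g t \<in> ball d' (1 / Suc n)" "t \<in> space M"
        using t by (simp_all add: R_def)
      ultimately show "t \<in> ?P" unfolding V_def by blast
    qed
    have sup: "?P - A \<subseteq> (\<Union>i\<in>I. R i)"
    proof
      fix t assume t: "t \<in> ?P - A"
      then have cl: "f t \<in> closure D" "g t \<in> closure D'" and "(f t, g t) \<in> V"
        using fgA by (auto simp: V_def)
      then obtain U U' where U: "open U" "open U'" "f t \<in> U" "g t \<in> U'" "U \<times> U' \<subseteq> V"
        using V open_prod_elim by (metis mem_Sigma_iff)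
      obtain e where e: "e > 0" "ball (f t) e \<subseteq> U" using U open_contains_ball by meson
      obtain e' where e': "e' > 0" "ball (g t) e' \<subseteq> U'" using U open_contains_ball by meson
      obtain n :: nat where n: "1 / Suc n < min e e' / 2"
        using nat_approx_posE[of "min e e' / 2"] e e' by auto
      have pos: "1 / real (Suc n) > 0" by simp
      obtain d where d: "d \<in> D" "dist d (f t) < 1 / Suc n"
        using cl(1) pos unfolding closure_approachable by blast
      obtain d' where d': "d' \<in> D'" "dist d' (g t) < 1 / Suc n"
        using cl(2) pos unfolding closure_approachable by blast
      have "ball d (1 / Suc n) \<subseteq> ball (f t) e"
      proof
        fix z assume "z \<in> ball d (1 / Suc n)"
        then have "dist d z < 1 / Suc n" by simp
        then show "z \<in> ball (f t) e"
          using d(2) n dist_triangle[of "f t" z d] by (simp add: dist_commute)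
      qed
      moreover have "ball d' (1 / Suc n) \<subseteq> ball (g t) e'"
      proof
        fix z assume "z \<in> ball d' (1 / Suc n)"
        then have "dist d' z < 1 / Suc n" by simp
        then show "z \<in> ball (g t) e'"
          using d'(2) n dist_triangle[of "g t" z d'] by (simp add: dist_commute)
      qed
      ultimately have "ball d (1 / Suc n) \<times> ball d' (1 / Suc n) \<subseteq> V"
        using U(5) e(2) e'(2) by blast
      then have "(d, d', n) \<in> I" using d(1) d'(1) by (simp add: I_def)
      moreover have "t \<in> R (d, d', n)" using t d(2) d'(2) by (simp add: R_def)
      ultimately show "t \<in> (\<Union>i\<in>I. R i)" by blast
    qed
    have "?P = (\<Union>i\<in>I. R i) \<union> (?P \<inter> A)" using sub sup by blast
    also have "\<dots> \<in> sets M"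
      by (rule sets.Un[OF R complete[OF _ A]]) simp
    finally show "?P \<in> sets M" .
  qed
  moreover have cl: "h ` closure (D \<times> D') \<subseteq> closure (h ` (D \<times> D'))"
    by (intro image_closure_subset continuous_on_subset[OF h] closure_subset closed_closure subset_UNIV)
  have "AE t in M. h (f t, g t) \<in> closure (h ` (D \<times> D'))"
    using fD gD by eventually_elim (use cl in \<open>auto simp: closure_Times\<close>)
  moreover have "countable (h ` (D \<times> D'))" using D D' by simp
  ultimately show ?thesis unfolding strongly_measurable_iff by blast
qed

section \<open>The Koethe-Bochner space as a module\<close>

context banach_function_space
begin

lemma kb_spaceD:
  assumes "f \<in> kb_space M E"
  shows "strongly_measurable M f" "f \<in> borel_measurable M" "(\<lambda>t. norm (f t)) \<in> E"
    "(\<lambda>t. norm (f t)) \<in> borel_measurable M"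
proof -
  show "strongly_measurable M f" "(\<lambda>t. norm (f t)) \<in> E"
    using assms by (auto simp: kb_space_def)
  then show "f \<in> borel_measurable M" by (simp add: strongly_measurable_def)
  then show "(\<lambda>t. norm (f t)) \<in> borel_measurable M" by measurable
qed

lemma kb_space_const: "(\<lambda>_. x) \<in> kb_space M E"
proof -
  have "AE t in M. x \<in> closure {x}" by simp
  then have "strongly_measurable M (\<lambda>_. x)"
    unfolding strongly_measurable_iff
    by (intro conjI exI[of _ "{x}"]) auto
  then show ?thesis using scale[OF one, of "norm x"] by (simp add: kb_space_def)
qed

lemma kb_space_dominated:
  assumes "strongly_measurable M f" "g \<in> E" "AE t in M. norm (f t) \<le> \<bar>g t\<bar>"
  shows "f \<in> kb_space M E"
proof -
  have "f \<in> borel_measurable M" using assms(1) by (simp add: strongly_measurable_def)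
  then have "(\<lambda>t. norm (f t)) \<in> borel_measurable M" by measurable
  then have "(\<lambda>t. norm (f t)) \<in> E" using ideal[OF assms(2)] assms(3) by simp
  then show ?thesis using assms(1) by (simp add: kb_space_def)
qed

lemma kb_space_Linfty_scaleR:
  fixes f :: "'w \<Rightarrow> 'x::real_normed_vector"
  assumes a: "a \<in> Linfty M" and f: "f \<in> kb_space M E"
  shows "(\<lambda>t. a t *\<^sub>R f t) \<in> kb_space M E"
proof -
  obtain C where C: "AE t in M. \<bar>a t\<bar> \<le> C" using a by (auto simp: Linfty_def)
  have cont: "continuous_on UNIV (\<lambda>z :: real \<times> 'x. fst z *\<^sub>R snd z)"
    by (intro continuous_intros)
  have "strongly_measurable M a" using a by (auto simp: Linfty_def intro: strongly_measurable_real)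
  then have "strongly_measurable M (\<lambda>t. a t *\<^sub>R f t)"
    using strongly_measurable_continuous_Pair[OF cont, of a f] kb_spaceD(1)[OF f] by simp
  moreover have "AE t in M. norm (a t *\<^sub>R f t) \<le> \<bar>C * norm (f t)\<bar>"
    using C
  proof eventually_elim
    case (elim t)
    have "norm (a t *\<^sub>R f t) \<le> C * norm (f t)" using elim by (simp add: mult_right_mono)
    then show ?case by linarith
  qed
  ultimately show ?thesis by (rule kb_space_dominated[OF _ scale[OF kb_spaceD(3)[OF f]]])
qed

lemma kb_space_add:
  fixes f g :: "'w \<Rightarrow> 'x::real_normed_vector"
  assumes f: "f \<in> kb_space M E" and g: "g \<in> kb_space M E"
  shows "(\<lambda>t. f t + g t) \<in> kb_space M E"
proof (rule kb_space_dominated[OF _ add[OF kb_spaceD(3)[OF f] kb_spaceD(3)[OF g]]])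
  have cont: "continuous_on UNIV (\<lambda>z :: 'x \<times> 'x. fst z + snd z)"
    by (intro continuous_intros)
  show "strongly_measurable M (\<lambda>t. f t + g t)"
    using strongly_measurable_continuous_Pair[OF cont kb_spaceD(1)[OF f] kb_spaceD(1)[OF g]] by simp
  show "AE t in M. norm (f t + g t) \<le> \<bar>norm (f t) + norm (g t)\<bar>"
    by (intro AE_I2) (simp add: norm_triangle_ineq)
qed

lemma const_in_Linfty: "(\<lambda>_. c) \<in> Linfty M"
  by (auto simp: Linfty_def)

lemma Linfty_mult:
  assumes "a \<in> Linfty M" "b \<in> Linfty M"
  shows "(\<lambda>t. a t * b t) \<in> Linfty M"
proof -
  obtain C C' where C: "AE t in M. \<bar>a t\<bar> \<le> C" "AE t in M. \<bar>b t\<bar> \<le> C'"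
    using assms by (auto simp: Linfty_def)
  have "AE t in M. \<bar>a t * b t\<bar> \<le> C * C'"
    using C
  proof eventually_elim
    case (elim t)
    then have "\<bar>a t\<bar> * \<bar>b t\<bar> \<le> C * C'" by (intro mult_mono) auto
    then show ?case by (simp add: abs_mult)
  qed
  moreover have "(\<lambda>t. a t * b t) \<in> borel_measurable M"
    using assms by (auto simp: Linfty_def)
  ultimately show ?thesis by (auto simp: Linfty_def)
qed

lemma kb_space_diff:
  assumes f: "f \<in> kb_space M E" and g: "g \<in> kb_space M E"
  shows "(\<lambda>t. f t - g t) \<in> kb_space M E"
  using kb_space_add[OF f kb_space_Linfty_scaleR[OF const_in_Linfty[of "-1"] g]] by simp

lemma kb_norm_mono:
  assumes "f \<in> kb_space M E" "g \<in> kb_space M E" "AE t in M. norm (f t) \<le> norm (g t)"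
  shows "kb_norm N f \<le> kb_norm N g"
  unfolding kb_norm_def using assms by (intro norm_mono kb_spaceD(3)) auto

lemma kb_norm_scaleR:
  assumes "f \<in> kb_space M E"
  shows "kb_norm N (\<lambda>t. c *\<^sub>R f t) = \<bar>c\<bar> * kb_norm N f"
  using norm_scale[OF kb_spaceD(3)[OF assms], of "\<bar>c\<bar>"] by (simp add: kb_norm_def)

lemma kb_norm_nonneg: "f \<in> kb_space M E \<Longrightarrow> 0 \<le> kb_norm N f"
  unfolding kb_norm_def by (intro norm_nonneg kb_spaceD(3))

lemma kb_norm_eq_0_iff: "f \<in> kb_space M E \<Longrightarrow> kb_norm N f = 0 \<longleftrightarrow> (AE t in M. f t = 0)"
  unfolding kb_norm_def using norm_eq_0_iff[OF kb_spaceD(3)] by simp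

section \<open>Values of elements of a cyclic subspace\<close>

lemma const_in_cyclic_subspace:
  fixes x :: "'x::real_normed_vector"
  shows "(\<lambda>_. x) \<in> cyclic_subspace M E N x"
proof -
  have "kb_norm N (\<lambda>t. x - 1 *\<^sub>R x) = 0"
    using kb_norm_eq_0_iff[OF kb_space_const[of "0 :: 'x"]] by simp
  then show ?thesis
    using const_in_Linfty[of 1] by (force simp: cyclic_subspace_def kb_space_const)
qed

end

lemma closed_span_singleton:
  fixes x :: "'a::real_normed_vector"
  shows "closed (span {x})"
proof (cases "x = 0")
  case False
  have "closed (range (\<lambda>c. c *\<^sub>R x))"
    by (rule complete_imp_closed, rule complete_isometric_image[of "norm x"])
      (use False in \<open>auto simp: bounded_linear_scaleR_left complete_UNIV\<close>)
  then show ?thesis by (simp add: span_singleton)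
qed simp

text \<open>
  The distance of \<open>f(t)\<close> from the line through \<open>x\<close> is bounded by \<open>\<bar>f(t) - a(t) x\<bar>\<close> for
  every \<open>a \<in> L\<^sup>\<infinity>\<close>. So the norm of this distance function is zero, and no almost everywhere
  convergent subsequence has to be chosen.
\<close>

lemma (in banach_function_space) cyclic_subspace_AE_span:
  assumes f: "f \<in> cyclic_subspace M E N x"
  shows "AE t in M. f t \<in> span {x}"
proof -
  have f_kb: "f \<in> kb_space M E" using f by (simp add: cyclic_subspace_def)
  define r where "r = (\<lambda>t. infdist (f t) (span {x}))"
  have "r \<in> borel_measurable M" unfolding r_def
    by (rule borel_measurable_continuous_on[OF _ kb_spaceD(2)[OF f_kb]])
      (intro continuous_intros)
  moreover have r_le: "\<bar>r t\<bar> \<le> norm (f t - c *\<^sub>R x)" for t c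
    unfolding r_def using infdist_le[of "c *\<^sub>R x" "span {x}" "f t"]
    by (simp add: infdist_nonneg dist_norm span_base span_scale)
  moreover have "\<bar>r t\<bar> \<le> norm (f t)" for t using r_le[of t 0] by simp
  ultimately have r: "r \<in> E" using ideal[OF kb_spaceD(3)[OF f_kb]] by simp
  have "N r \<le> e" if e: "e > 0" for e
  proof -
    obtain a where a: "a \<in> Linfty M" "kb_norm N (\<lambda>t. f t - a t *\<^sub>R x) < e"
      using f e unfolding cyclic_subspace_def by blast
    have "(\<lambda>t. f t - a t *\<^sub>R x) \<in> kb_space M E"
      by (intro kb_space_diff f_kb kb_space_Linfty_scaleR a kb_space_const)
    then have "N r \<le> kb_norm N (\<lambda>t. f t - a t *\<^sub>R x)"
      unfolding kb_norm_def using r_le by (intro norm_mono kb_spaceD(3) r) auto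
    then show ?thesis using a(2) by simp
  qed
  then have "N r = 0" using norm_nonneg[OF r] by (metis dense_ge order_antisym)
  then have "AE t in M. r t = 0" using norm_eq_0_iff[OF r] by simp
  then show ?thesis
    unfolding r_def
    by eventually_elim
      (use in_closed_iff_infdist_zero[OF closed_span_singleton] span_zero in blast)
qed

section \<open>Multiplication operators have the two properties\<close>

context kb_operator
begin

lemma multiplication_operator_commutes:
  assumes "multiplication_operator M E T"
  shows "commutes_with_Linfty M E T"
  unfolding commutes_with_Linfty_def
proof (intro ballI)
  fix b and f :: "'w \<Rightarrow> 'x" assume b: "b \<in> Linfty M" and f: "f \<in> kb_space M E"
  obtain a where a: "\<And>f. f \<in> kb_space M E \<Longrightarrow> AE t in M. T f t = a t *\<^sub>R f t"
    using assms by (auto simp: multiplication_operator_def)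
  show "AE t in M. T (\<lambda>s. b s *\<^sub>R f s) t = b t *\<^sub>R T f t"
    using a[OF f] a[OF kb_space_Linfty_scaleR[OF b f]]
    by eventually_elim (simp add: mult.commute)
qed

lemma multiplication_operator_cyclic_invariant:
  assumes "multiplication_operator M E T" and f: "f \<in> cyclic_subspace M E N x"
  shows "T f \<in> cyclic_subspace M E N x"
proof -
  obtain a where a: "a \<in> Linfty M" and Ta: "\<And>f. f \<in> kb_space M E \<Longrightarrow> AE t in M. T f t = a t *\<^sub>R f t"
    using assms by (auto simp: multiplication_operator_def)
  obtain C0 where C0: "AE t in M. \<bar>a t\<bar> \<le> C0" using a by (auto simp: Linfty_def)
  define C where "C = \<bar>C0\<bar> + 1"
  have C: "AE t in M. \<bar>a t\<bar> \<le> C" "C > 0"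
    using C0 by (auto simp: C_def elim: eventually_mono)
  have f_kb: "f \<in> kb_space M E" using f by (simp add: cyclic_subspace_def)
  have "\<exists>b\<in>Linfty M. kb_norm N (\<lambda>t. T f t - b t *\<^sub>R x) < e" if "e > 0" for e
  proof -
    have "e / C > 0" using that C by simp
    then obtain b where b: "b \<in> Linfty M" "kb_norm N (\<lambda>t. f t - b t *\<^sub>R x) < e / C"
      using f unfolding cyclic_subspace_def by blast
    note ab = Linfty_mult[OF a b(1)]
    have d: "(\<lambda>t. f t - b t *\<^sub>R x) \<in> kb_space M E"
      by (intro kb_space_diff f_kb kb_space_Linfty_scaleR b kb_space_const)
    have "kb_norm N (\<lambda>t. T f t - (a t * b t) *\<^sub>R x) \<le> kb_norm N (\<lambda>t. C *\<^sub>R (f t - b t *\<^sub>R x))"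
    proof (rule kb_norm_mono)
      show "(\<lambda>t. T f t - (a t * b t) *\<^sub>R x) \<in> kb_space M E"
        by (intro kb_space_diff T_in f_kb kb_space_Linfty_scaleR ab kb_space_const)
      show "(\<lambda>t. C *\<^sub>R (f t - b t *\<^sub>R x)) \<in> kb_space M E"
        by (intro kb_space_Linfty_scaleR[OF const_in_Linfty] d)
      show "AE t in M. norm (T f t - (a t * b t) *\<^sub>R x) \<le> norm (C *\<^sub>R (f t - b t *\<^sub>R x))"
        using Ta[OF f_kb] C(1)
      proof eventually_elim
        case (elim t)
        have "T f t - (a t * b t) *\<^sub>R x = a t *\<^sub>R (f t - b t *\<^sub>R x)"
          using elim by (simp add: scaleR_diff_right)
        then show ?case using elim C(2) by (simp add: mult_right_mono)
      qed
    qed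
    also have "\<dots> = C * kb_norm N (\<lambda>t. f t - b t *\<^sub>R x)"
      using kb_norm_scaleR[OF d, of C] C(2) by simp
    also have "\<dots> < e" using b(2) C(2) by (simp add: field_simps)
    finally show ?thesis by (intro bexI[OF _ ab])
  qed
  then show ?thesis using T_in[OF f_kb] by (simp add: cyclic_subspace_def)
qed

section \<open>Operators that commute with bounded functions are local\<close>

text \<open>
  On the set \<open>A\<close> where \<open>\<bar>T f\<bar> > K \<bar>f\<bar>\<close> the bound
  \<open>K \<parallel>1\<^sub>A f\<parallel> \<le> \<parallel>1\<^sub>A T f\<parallel> = \<parallel>T (1\<^sub>A f)\<parallel> \<le> K\<^sub>0 \<parallel>1\<^sub>A f\<parallel>\<close>, for \<open>K\<close> larger than an
  operator bound \<open>K\<^sub>0\<close>, forces \<open>1\<^sub>A f\<close> and hence \<open>1\<^sub>A T f\<close> to vanish. Since \<open>T f\<close> is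
  nonzero on \<open>A\<close>, the set \<open>A\<close> is null.
\<close>

lemma pointwise_domination:
  assumes comm: "commutes_with_Linfty M E T"
  obtains K where "\<And>f. f \<in> kb_space M E \<Longrightarrow> AE t in M. norm (T f t) \<le> K * norm (f t)"
proof -
  obtain K0 where K0: "\<And>f. f \<in> kb_space M E \<Longrightarrow> kb_norm N (T f) \<le> K0 * kb_norm N f"
    using T_bounded by blast
  define K where "K = \<bar>K0\<bar> + 1"
  have K: "K > K0" "K > 0" by (auto simp: K_def)
  have "AE t in M. norm (T f t) \<le> K * norm (f t)" if f: "f \<in> kb_space M E" for f
  proof -
    note [measurable] = kb_spaceD(4)[OF f] kb_spaceD(4)[OF T_in[OF f]]
    define A where "A = {t \<in> space M. K * norm (f t) < norm (T f t)}"
    have [measurable]: "A \<in> sets M" unfolding A_def by measurable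
    let ?i = "indicator A :: 'w \<Rightarrow> real"
    have i: "?i \<in> Linfty M"
      by (auto simp: Linfty_def indicator_def intro!: exI[of _ 1])
    let ?f = "\<lambda>t. ?i t *\<^sub>R f t" and ?Tf = "\<lambda>t. ?i t *\<^sub>R T f t"
    have f_kb: "?f \<in> kb_space M E" by (intro kb_space_Linfty_scaleR i f)
    have Tf_kb: "?Tf \<in> kb_space M E" by (intro kb_space_Linfty_scaleR i T_in f)
    have eq: "AE t in M. T ?f t = ?Tf t"
      using comm i f by (auto simp: commutes_with_Linfty_def)
    have "kb_norm N ?Tf \<le> kb_norm N (T ?f)"
      by (rule kb_norm_mono[OF Tf_kb T_in[OF f_kb]]) (use eq in \<open>auto elim: eventually_mono\<close>)
    also have "\<dots> \<le> K0 * kb_norm N ?f" by (rule K0[OF f_kb])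
    finally have upper: "kb_norm N ?Tf \<le> K0 * kb_norm N ?f" .
    have "kb_norm N (\<lambda>t. K *\<^sub>R ?f t) \<le> kb_norm N ?Tf"
    proof (rule kb_norm_mono[OF kb_space_Linfty_scaleR[OF const_in_Linfty f_kb] Tf_kb])
      show "AE t in M. norm (K *\<^sub>R ?f t) \<le> norm (?Tf t)"
        using K(2) by (intro AE_I2) (auto simp: A_def indicator_def)
    qed
    then have lower: "K * kb_norm N ?f \<le> kb_norm N ?Tf"
      using kb_norm_scaleR[OF f_kb, of K] K(2) by simp
    have "(K - K0) * kb_norm N ?f \<le> 0" using upper lower by (simp add: algebra_simps)
    then have "kb_norm N ?f = 0"
      using kb_norm_nonneg[OF f_kb] K(1) by (simp add: mult_le_0_iff)
    then have "kb_norm N ?Tf = 0"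
      using upper kb_norm_nonneg[OF Tf_kb] by simp
    then have "AE t in M. ?Tf t = 0" using kb_norm_eq_0_iff[OF Tf_kb] by simp
    then show ?thesis
      using AE_space
    proof eventually_elim
      case (elim t)
      show ?case
      proof (rule ccontr)
        assume "\<not> ?case"
        then have "t \<in> A" "K * norm (f t) < norm (T f t)" using elim by (auto simp: A_def)
        moreover have "K * norm (f t) \<ge> 0" using K(2) by simp
        ultimately show False using elim by auto
      qed
    qed
  qed
  then show ?thesis using that by blast
qed

lemma T_diff:
  assumes f: "f \<in> kb_space M E" and g: "g \<in> kb_space M E"
  shows "AE t in M. T (\<lambda>s. f s - g s) t = T f t - T g t"
  using T_add[OF f kb_space_Linfty_scaleR[OF const_in_Linfty[of "-1"] g]] T_scale[OF g, of "-1"]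
  by eventually_elim simp

end

section \<open>One multiplier for all constant functions\<close>

text \<open>
  Here \<open>a x\<close>, \<open>v\<close> and \<open>a x + v\<close> play the role of the values at one point of the images
  of \<open>x\<close>, \<open>y\<close> and \<open>x + y\<close>. Since \<open>x\<close> and \<open>y\<close> are independent, comparing
  coefficients identifies the three eigenvalues.
\<close>

lemma eigenvalues_agree:
  fixes x y :: "'a::real_vector"
  assumes x: "x \<noteq> 0" and v: "v \<in> span {y}" and sum: "a *\<^sub>R x + v \<in> span {x + y}" and y: "y \<notin> span {x}"
  shows "v = a *\<^sub>R y"
proof -
  obtain b where b: "v = b *\<^sub>R y" using v by (auto simp: span_singleton)
  obtain c where c: "a *\<^sub>R x + v = c *\<^sub>R (x + y)" using sum by (auto simp: span_singleton)
  have eq: "(b - c) *\<^sub>R y = (c - a) *\<^sub>R x"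
    using b c by (simp add: algebra_simps)
  have "b = c"
  proof (rule ccontr)
    assume "b \<noteq> c"
    then have "y = inverse (b - c) *\<^sub>R ((b - c) *\<^sub>R y)" by simp
    then have "y = (inverse (b - c) * (c - a)) *\<^sub>R x" unfolding eq by simp
    then show False using y by (auto simp: span_singleton)
  qed
  moreover have "c = a" using eq x \<open>b = c\<close> by simp
  ultimately show ?thesis using b by simp
qed

context kb_operator
begin

lemma constants_common_multiplier:
  assumes inv: "\<And>x. T ` cyclic_subspace M E N x \<subseteq> cyclic_subspace M E N x"
    and K: "\<And>f. f \<in> kb_space M E \<Longrightarrow> AE t in M. norm (T f t) \<le> K * norm (f t)"
  obtains a where "a \<in> Linfty M" "\<And>y. AE t in M. T (\<lambda>_. y) t = a t *\<^sub>R y"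
proof (cases "\<exists>x :: 'x. x \<noteq> 0")
  case False
  then have "y = 0" for y :: 'x by blast
  then have "AE t in M. T (\<lambda>_. y) t = 0 *\<^sub>R y" for y by (metis (mono_tags, lifting) AE_I2)
  then show ?thesis using that[OF const_in_Linfty[of 0]] by simp
next
  case True
  then obtain x :: 'x where x: "x \<noteq> 0" by blast
  have span: "AE t in M. T (\<lambda>_. y) t \<in> span {y}" for y
    using cyclic_subspace_AE_span[of "T (\<lambda>_. y)" y] inv[of y] const_in_cyclic_subspace[of y] by blast
  \<comment> \<open>The coefficient of \<open>x\<close> in \<open>T x + K x\<close> is nonnegative, so it can be read off from a norm;
    this makes the coefficient of \<open>x\<close> in \<open>T x\<close> measurable.\<close>
  define a where "a = (\<lambda>t. norm (T (\<lambda>_. x) t + K *\<^sub>R x) / norm x - K)"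
  have *: "AE t in M. \<bar>a t\<bar> \<le> K \<and> T (\<lambda>_. x) t = a t *\<^sub>R x"
    using span[of x] K[OF kb_space_const[of x]]
  proof eventually_elim
    case (elim t)
    then obtain c where c: "T (\<lambda>_. x) t = c *\<^sub>R x" by (auto simp: span_singleton)
    have "\<bar>c\<bar> \<le> K" using elim(2) x by (simp add: c)
    moreover have "norm (T (\<lambda>_. x) t + K *\<^sub>R x) = \<bar>c + K\<bar> * norm x"
      unfolding c by (simp flip: scaleR_left_distrib)
    ultimately have "a t = c" using x by (simp add: a_def)
    then show ?case using c \<open>\<bar>c\<bar> \<le> K\<close> by simp
  qed
  have "(\<lambda>t. norm (T (\<lambda>_. x) t + K *\<^sub>R x)) \<in> borel_measurable M"
    by (rule borel_measurable_continuous_on[OF _ kb_spaceD(2)[OF T_in[OF kb_space_const]]])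
      (intro continuous_intros)
  then have "a \<in> borel_measurable M" unfolding a_def by measurable
  then have a: "a \<in> Linfty M" using * by (auto simp: Linfty_def elim: eventually_mono)
  have "AE t in M. T (\<lambda>_. y) t = a t *\<^sub>R y" for y
  proof (cases "y \<in> span {x}")
    case True
    then obtain k where k: "y = k *\<^sub>R x" by (auto simp: span_singleton)
    show ?thesis
      using * T_scale[OF kb_space_const[of x], of k]
      by eventually_elim (simp add: k mult.commute)
  next
    case False
    show ?thesis
      using * span[of y] span[of "x + y"] T_add[OF kb_space_const[of x] kb_space_const[of y]]
      by eventually_elim (auto intro: eigenvalues_agree[OF x _ _ False])
  qed
  then show ?thesis using that[OF a] by blast
qed

section \<open>From constants to all functions\<close>

text \<open>
  The comparison of \<open>f\<close> with a vector \<open>d\<close> reads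
  \<open>\<bar>T f(t) - a(t) d\<bar> \<le> K \<bar>f(t) - d\<bar>\<close>. The vectors \<open>d\<close> with this property form a
  closed set, so for almost every \<open>t\<close> it contains \<open>f(t)\<close> itself.
\<close>

lemma multiplication_on_constants_extends:
  assumes K: "\<And>f. f \<in> kb_space M E \<Longrightarrow> AE t in M. norm (T f t) \<le> K * norm (f t)"
    and a: "\<And>y. AE t in M. T (\<lambda>_. y) t = a t *\<^sub>R y"
    and f: "f \<in> kb_space M E"
  shows "AE t in M. T f t = a t *\<^sub>R f t"
proof -
  obtain D where D: "countable D" "AE t in M. f t \<in> closure D"
    using kb_spaceD(1)[OF f] unfolding strongly_measurable_iff by blast
  have "AE t in M. norm (T f t - a t *\<^sub>R d) \<le> K * norm (f t - d)" for d
    using a[of d] T_diff[OF f kb_space_const[of d]] K[OF kb_space_diff[OF f kb_space_const[of d]]]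
    by eventually_elim simp
  then have "AE t in M. \<forall>d\<in>D. norm (T f t - a t *\<^sub>R d) \<le> K * norm (f t - d)"
    using D(1) by (simp add: AE_ball_countable)
  then show ?thesis
    using D(2)
  proof eventually_elim
    case (elim t)
    let ?S = "{z. norm (T f t - a t *\<^sub>R z) \<le> K * norm (f t - z)}"
    have "closed ?S" by (intro closed_Collect_le continuous_intros)
    moreover have "D \<subseteq> ?S" using elim(1) by blast
    ultimately have "f t \<in> ?S" using closure_minimal elim(2) by blast
    then show ?case by simp
  qed
qed

end

section \<open>The characterization\<close>

theorem theorem7:
  fixes M :: "'w measure"
    and E :: "('w \<Rightarrow> real) set"
    and N :: "('w \<Rightarrow> real) \<Rightarrow> real"
    and T :: "('w \<Rightarrow> 'x::banach) \<Rightarrow> ('w \<Rightarrow> 'x)"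
  assumes "banach_function_space M E N"
    and "kb_operator M E N T"
  shows "multiplication_operator M E T \<longleftrightarrow>
    (\<forall>x. T ` cyclic_subspace M E N x \<subseteq> cyclic_subspace M E N x) \<and>
    commutes_with_Linfty M E T"
proof -
  interpret kb_operator M E N T by fact
  show ?thesis
  proof
    assume "multiplication_operator M E T"
    then show "(\<forall>x. T ` cyclic_subspace M E N x \<subseteq> cyclic_subspace M E N x) \<and>
        commutes_with_Linfty M E T"
      using multiplication_operator_cyclic_invariant multiplication_operator_commutes by blast
  next
    assume *: "(\<forall>x. T ` cyclic_subspace M E N x \<subseteq> cyclic_subspace M E N x) \<and>
        commutes_with_Linfty M E T"
    then obtain K where K: "\<And>f. f \<in> kb_space M E \<Longrightarrow> AE t in M. norm (T f t) \<le> K * norm (f t)"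
      using pointwise_domination by blast
    obtain a where "a \<in> Linfty M" "\<And>y. AE t in M. T (\<lambda>_. y) t = a t *\<^sub>R y"
      using constants_common_multiplier[OF _ K] * by blast
    then show "multiplication_operator M E T"
      unfolding multiplication_operator_def
      using multiplication_on_constants_extends[OF K] by blast
  qed
qed

end
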